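(* Let $S$ be an $F$-inverse monoid and let $H\subseteq S$. Define the relation $\tilde{\tau}_H$ on $S$ by setting, for all $a,b\in S$, $a\mathrel{\tilde{\tau}_H}b$ if and only if $a\mathrel{\tau_H}b$ and $$u(xay)^{\mathfrak m}v\in H\iff u(xby)^{\mathfrak m}v\in H\quad\text{for all }x,y,u,v\in S.$$ Then $\tilde{\tau}_H$ is the greatest $F$-congruence on $S$ saturating $H$.
   Context: For an inverse semigroup $S$, $E(S)$ is its set of idempotents, $\leq$ is the natural partial order ($s\leq t$ iff $s=et$ for some $e\in E(S)$), and $\sigma$ is the minimum group congruence ($s\mathrel{\sigma}t$ iff $es=et$ for some $e\in E(S)$). $S$ is $F$-inverse if every $\sigma$-class has a maximum element with respect to $\leq$; such an $S$ is automatically a monoid. For $a\in S$, $a^{\mathfrak m}$ denotes the maximum element of the $\sigma$-class of $a$. An $F$-congruence on an $F$-inverse monoid $S$ is a (two-sided, multiplicative) congruence $\rho$ such that $a\mathrel{\rho}b$ implies $a^{\mathfrak m}\mathrel{\rho}b^{\mathfrak m}$ for all $a,b\in S$. A congruence $\rho$ saturates $H\subseteq S$ if $H$ is a union of $\rho$-classes. The syntactic congruence $\tau_H$ of $H$ is defined by: $a\mathrel{\tau_H}b$ iff for all $x,y\in S^1$, $xay\in H\iff xby\in H$ (here $S^1=S$ since $S$ is a monoid). "Greatest" is with respect to inclusion of relations. *)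

theory Defs
  imports "HOL-Algebra.Group"
begin

section \<open>Inverse semigroups\<close>

text \<open>An inverse semigroup is a semigroup in which every element \<open>s\<close> has a unique
  (generalised) inverse \<open>t\<close>, that is, a unique \<open>t\<close> with \<open>sts = s\<close> and \<open>tst = t\<close>.
  The unit field of the record plays no role here.\<close>

locale inverse_semigroup =
  fixes S (structure)
  assumes mult_closed: "\<lbrakk>x \<in> carrier S; y \<in> carrier S\<rbrakk> \<Longrightarrow> x \<otimes> y \<in> carrier S"
    and mult_assoc: "\<lbrakk>x \<in> carrier S; y \<in> carrier S; z \<in> carrier S\<rbrakk>
      \<Longrightarrow> (x \<otimes> y) \<otimes> z = x \<otimes> (y \<otimes> z)"
    and ex1_inverse: "s \<in> carrier S
      \<Longrightarrow> \<exists>!t. t \<in> carrier S \<and> s \<otimes> t \<otimes> s = s \<and> t \<otimes> s \<otimes> t = t"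

definition idempotents :: "('a, 'm) monoid_scheme \<Rightarrow> 'a set"
  where "idempotents S = {e \<in> carrier S. e \<otimes>\<^bsub>S\<^esub> e = e}"

definition natural_le :: "('a, 'm) monoid_scheme \<Rightarrow> 'a \<Rightarrow> 'a \<Rightarrow> bool"
  where "natural_le S s t \<longleftrightarrow> (\<exists>e \<in> idempotents S. s = e \<otimes>\<^bsub>S\<^esub> t)"

definition min_group_cong :: "('a, 'm) monoid_scheme \<Rightarrow> 'a rel"
  where "min_group_cong S = {(s, t). s \<in> carrier S \<and> t \<in> carrier S \<and>
    (\<exists>e \<in> idempotents S. e \<otimes>\<^bsub>S\<^esub> s = e \<otimes>\<^bsub>S\<^esub> t)}"


section \<open>\<open>F\<close>-inverse monoids\<close>

definition is_maximum :: "('a, 'm) monoid_scheme \<Rightarrow> 'a set \<Rightarrow> 'a \<Rightarrow> bool"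
  where "is_maximum S C m \<longleftrightarrow> m \<in> C \<and> (\<forall>s \<in> C. natural_le S s m)"

text \<open>Every \<open>F\<close>-inverse semigroup has an identity; requiring \<^locale>\<open>monoid\<close> only says that
  the unit field of the record is that identity.\<close>

locale F_inverse_monoid = monoid S + inverse_semigroup S for S (structure) +
  assumes class_has_maximum:
    "C \<in> carrier S // min_group_cong S \<Longrightarrow> \<exists>m. is_maximum S C m"

text \<open>\<open>a\<^sup>\<mm>\<close>, the maximum element of the \<open>\<sigma>\<close>-class of \<open>a\<close>\<close>

definition max_elt :: "('a, 'm) monoid_scheme \<Rightarrow> 'a \<Rightarrow> 'a"
  where "max_elt S a = (THE m. is_maximum S (min_group_cong S `` {a}) m)"


section \<open>Congruences\<close>

definition congruence :: "('a, 'm) monoid_scheme \<Rightarrow> 'a rel \<Rightarrow> bool"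
  where "congruence S \<rho> \<longleftrightarrow> equiv (carrier S) \<rho> \<and>
    (\<forall>a b c d. (a, b) \<in> \<rho> \<longrightarrow> (c, d) \<in> \<rho> \<longrightarrow> (a \<otimes>\<^bsub>S\<^esub> c, b \<otimes>\<^bsub>S\<^esub> d) \<in> \<rho>)"

definition F_congruence :: "('a, 'm) monoid_scheme \<Rightarrow> 'a rel \<Rightarrow> bool"
  where "F_congruence S \<rho> \<longleftrightarrow> congruence S \<rho> \<and>
    (\<forall>a b. (a, b) \<in> \<rho> \<longrightarrow> (max_elt S a, max_elt S b) \<in> \<rho>)"

definition saturates :: "('a, 'm) monoid_scheme \<Rightarrow> 'a rel \<Rightarrow> 'a set \<Rightarrow> bool"
  where "saturates S \<rho> H \<longleftrightarrow> (\<exists>\<C>. \<C> \<subseteq> carrier S // \<rho> \<and> H = \<Union>\<C>)"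

text \<open>In both definitions below, \<open>S\<close> is meant to be a monoid, so that the contexts range over
  \<open>S\<^sup>1 = S\<close>.\<close>

definition syntactic_cong :: "('a, 'm) monoid_scheme \<Rightarrow> 'a set \<Rightarrow> 'a rel"
  where "syntactic_cong S H = {(a, b). a \<in> carrier S \<and> b \<in> carrier S \<and>
    (\<forall>x \<in> carrier S. \<forall>y \<in> carrier S.
      x \<otimes>\<^bsub>S\<^esub> a \<otimes>\<^bsub>S\<^esub> y \<in> H \<longleftrightarrow> x \<otimes>\<^bsub>S\<^esub> b \<otimes>\<^bsub>S\<^esub> y \<in> H)}"

definition F_syntactic_cong :: "('a, 'm) monoid_scheme \<Rightarrow> 'a set \<Rightarrow> 'a rel"
  where "F_syntactic_cong S H = {(a, b). (a, b) \<in> syntactic_cong S H \<and>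
    (\<forall>x \<in> carrier S. \<forall>y \<in> carrier S. \<forall>u \<in> carrier S. \<forall>v \<in> carrier S.
      u \<otimes>\<^bsub>S\<^esub> max_elt S (x \<otimes>\<^bsub>S\<^esub> a \<otimes>\<^bsub>S\<^esub> y) \<otimes>\<^bsub>S\<^esub> v \<in> H \<longleftrightarrow>
      u \<otimes>\<^bsub>S\<^esub> max_elt S (x \<otimes>\<^bsub>S\<^esub> b \<otimes>\<^bsub>S\<^esub> y) \<otimes>\<^bsub>S\<^esub> v \<in> H)}"

end

theory Submission
  imports Defs
begin

text \<open>A congruence that saturates \<open>H\<close> cannot separate \<open>xay\<close> from \<open>xby\<close> by membership in \<open>H\<close>
  when it relates \<open>a\<close> to \<open>b\<close>; if it also respects \<open>\<mm>\<close>, the same holds for \<open>u(xay)\<^sup>\<mm>v\<close>.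
  So the conditions that define \<open>\<tau>\<^sub>H\<close>-tilde are forced on every \<open>F\<close>-congruence saturating \<open>H\<close>, and
  the point is that they already define such an \<open>F\<close>-congruence. Contexts compose, which gives
  compatibility with products, and the trivial context gives saturation.

  Closure under \<open>\<mm>\<close> might seem to need contexts in which \<open>\<mm>\<close> is nested ever deeper. It does
  not, because \<open>(x a\<^sup>\<mm> y)\<^sup>\<mm> = (xay)\<^sup>\<mm>\<close>: an inner \<open>\<mm>\<close> is absorbed by an outer one
  (\<open>max_elt_context\<close>). This holds because \<open>a\<close> and \<open>a\<^sup>\<mm>\<close> are \<open>\<sigma>\<close>-related, \<open>\<sigma>\<close> is compatible with
  multiplication on both sides, and \<open>\<mm>\<close> is constant on \<open>\<sigma>\<close>-classes. The facts needed about \<open>\<sigma>\<close>, and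
  the uniqueness of maxima, all come from the commuting of idempotents.\<close>

section \<open>Idempotents and the natural partial order\<close>

context inverse_semigroup
begin

lemma inverse_unique:
  assumes "s \<in> carrier S"
    and "t \<in> carrier S" "s \<otimes> t \<otimes> s = s" "t \<otimes> s \<otimes> t = t"
    and "t' \<in> carrier S" "s \<otimes> t' \<otimes> s = s" "t' \<otimes> s \<otimes> t' = t'"
  shows "t = t'"
  using ex1_inverse[OF assms(1)] assms by blast

lemma idempotents_closed: "e \<in> idempotents S \<Longrightarrow> e \<in> carrier S"
  by (simp add: idempotents_def)

lemma idempotents_idem: "e \<in> idempotents S \<Longrightarrow> e \<otimes> e = e"
  by (simp add: idempotents_def)

lemma idempotents_idem_left:
  assumes "e \<in> idempotents S" "a \<in> carrier S"
  shows "e \<otimes> (e \<otimes> a) = e \<otimes> a"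
  using assms by (metis idempotents_closed idempotents_idem mult_assoc)

text \<open>If \<open>x\<close> is the inverse of \<open>ef\<close>, then \<open>fxe\<close> is an inverse of \<open>ef\<close> too, hence equal to \<open>x\<close>,
  which makes \<open>x\<close> idempotent. An idempotent is its own inverse, so \<open>ef = x\<close>.\<close>

lemma idempotents_mult:
  assumes e: "e \<in> idempotents S" and f: "f \<in> idempotents S"
  shows "e \<otimes> f \<in> idempotents S"
proof -
  note ec = idempotents_closed[OF e] and fc = idempotents_closed[OF f]
  note closed = mult_closed ec fc
  obtain x where x: "x \<in> carrier S" "e \<otimes> f \<otimes> x \<otimes> (e \<otimes> f) = e \<otimes> f"
      "x \<otimes> (e \<otimes> f) \<otimes> x = x"
    using ex1_inverse[of "e \<otimes> f"] closed by blast
  have x_absorb: "x \<otimes> (e \<otimes> (f \<otimes> (x \<otimes> z))) = x \<otimes> z" if "z \<in> carrier S" for z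
    using arg_cong[OF x(3), of "\<lambda>w. w \<otimes> z"] that x(1) by (simp add: mult_assoc closed)
  have "x = f \<otimes> x \<otimes> e"
  proof (rule inverse_unique[of "e \<otimes> f"])
    show "e \<otimes> f \<otimes> (f \<otimes> x \<otimes> e) \<otimes> (e \<otimes> f) = e \<otimes> f"
      using x by (simp add: mult_assoc closed idempotents_idem_left e f)
    show "f \<otimes> x \<otimes> e \<otimes> (e \<otimes> f) \<otimes> (f \<otimes> x \<otimes> e) = f \<otimes> x \<otimes> e"
      using x(1) by (simp add: mult_assoc closed idempotents_idem_left e f x_absorb)
  qed (use x closed in simp_all)
  moreover have "(f \<otimes> x \<otimes> e) \<otimes> (f \<otimes> x \<otimes> e) = f \<otimes> x \<otimes> e"
    using x(1) by (simp add: mult_assoc closed x_absorb)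
  ultimately have xx: "x \<otimes> x = x"
    by simp
  have "e \<otimes> f = x"
    by (rule inverse_unique[of x]) (use x xx closed in simp_all)
  with x(1) xx show ?thesis
    by (simp add: idempotents_def)
qed

text \<open>Both \<open>ef\<close> and \<open>fe\<close> are inverses of the idempotent \<open>ef\<close>.\<close>

lemma idempotents_commute:
  assumes e: "e \<in> idempotents S" and f: "f \<in> idempotents S"
  shows "e \<otimes> f = f \<otimes> e"
proof -
  note ec = idempotents_closed[OF e] and fc = idempotents_closed[OF f]
  note closed = mult_closed ec fc
  have ef: "e \<otimes> f \<otimes> (e \<otimes> f) = e \<otimes> f" and fe: "f \<otimes> e \<otimes> (f \<otimes> e) = f \<otimes> e"
    using idempotents_mult e f by (simp_all add: idempotents_idem)
  show ?thesis
  proof (rule inverse_unique[of "e \<otimes> f"])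
    show "e \<otimes> f \<otimes> (f \<otimes> e) \<otimes> (e \<otimes> f) = e \<otimes> f"
      using ef by (simp add: mult_assoc closed idempotents_idem_left e f)
    show "f \<otimes> e \<otimes> (e \<otimes> f) \<otimes> (f \<otimes> e) = f \<otimes> e"
      using fe by (simp add: mult_assoc closed idempotents_idem_left e f)
  qed (simp_all add: closed ef)
qed

lemma idempotents_left_commute:
  assumes "e \<in> idempotents S" "f \<in> idempotents S" "a \<in> carrier S"
  shows "e \<otimes> (f \<otimes> a) = f \<otimes> (e \<otimes> a)"
  using assms by (metis idempotents_closed idempotents_commute mult_assoc)

lemma natural_le_antisym:
  assumes "s \<in> carrier S" "t \<in> carrier S" "natural_le S s t" "natural_le S t s"
  shows "s = t"
proof -
  obtain e f where e: "e \<in> idempotents S" "s = e \<otimes> t" and f: "f \<in> idempotents S" "t = f \<otimes> s"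
    using assms(3,4) unfolding natural_le_def by blast
  have "e \<otimes> s = s"
    using e assms(2) by (simp add: idempotents_idem_left)
  have "s = e \<otimes> (f \<otimes> s)"
    using e f by simp
  also have "\<dots> = f \<otimes> (e \<otimes> s)"
    using e f assms(1) by (simp add: idempotents_left_commute)
  also have "\<dots> = t"
    using \<open>e \<otimes> s = s\<close> f by simp
  finally show ?thesis .
qed

lemma is_maximum_unique:
  assumes "C \<subseteq> carrier S" "is_maximum S C m" "is_maximum S C m'"
  shows "m = m'"
  using assms natural_le_antisym unfolding is_maximum_def by blast

end


section \<open>The minimum group congruence\<close>

context inverse_semigroup
begin

text \<open>If \<open>e\<close> witnesses the first relation and \<open>f\<close> the second, then \<open>fe\<close> witnesses the composite.\<close>

lemma min_group_cong_trans:
  assumes "(a, b) \<in> min_group_cong S" "(b, c) \<in> min_group_cong S"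
  shows "(a, c) \<in> min_group_cong S"
proof -
  obtain e f where e: "e \<in> idempotents S" "e \<otimes> a = e \<otimes> b"
    and f: "f \<in> idempotents S" "f \<otimes> b = f \<otimes> c"
    and abc: "a \<in> carrier S" "b \<in> carrier S" "c \<in> carrier S"
    using assms unfolding min_group_cong_def by blast
  have "f \<otimes> e \<otimes> a = f \<otimes> (e \<otimes> b)"
    using e f abc by (simp add: mult_assoc idempotents_closed)
  also have "\<dots> = e \<otimes> (f \<otimes> c)"
    using e f abc idempotents_left_commute[of f e b] by simp
  also have "\<dots> = f \<otimes> e \<otimes> c"
    using e f abc idempotents_left_commute[of e f c] by (simp add: mult_assoc idempotents_closed)
  finally show ?thesis
    using abc idempotents_mult[OF f(1) e(1)] unfolding min_group_cong_def by blast
qed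

lemma min_group_cong_sym:
  "(a, b) \<in> min_group_cong S \<Longrightarrow> (b, a) \<in> min_group_cong S"
  unfolding min_group_cong_def by force

lemma min_group_cong_class_eq:
  assumes "(a, b) \<in> min_group_cong S"
  shows "min_group_cong S `` {a} = min_group_cong S `` {b}"
  using assms by (blast intro: min_group_cong_trans min_group_cong_sym)

lemma min_group_cong_mult_right:
  assumes "(a, b) \<in> min_group_cong S" "y \<in> carrier S"
  shows "(a \<otimes> y, b \<otimes> y) \<in> min_group_cong S"
proof -
  obtain e where e: "e \<in> idempotents S" "e \<otimes> a = e \<otimes> b"
    and ab: "a \<in> carrier S" "b \<in> carrier S"
    using assms(1) unfolding min_group_cong_def by blast
  have "e \<otimes> (a \<otimes> y) = e \<otimes> (b \<otimes> y)"
    using e ab assms(2) by (metis idempotents_closed mult_assoc)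
  then show ?thesis
    using e ab assms(2) unfolding min_group_cong_def by (auto simp: mult_closed)
qed

text \<open>If \<open>ea = eb\<close> and \<open>x'\<close> is the inverse of \<open>x\<close>, then the conjugate \<open>xex'\<close> is an idempotent with
  \<open>xex'x = xx'xe = xe\<close>, so it carries the witness \<open>e\<close> past the new left factor \<open>x\<close>.\<close>

lemma min_group_cong_mult_left:
  assumes "(a, b) \<in> min_group_cong S" "x \<in> carrier S"
  shows "(x \<otimes> a, x \<otimes> b) \<in> min_group_cong S"
proof -
  obtain e where e: "e \<in> idempotents S" "e \<otimes> a = e \<otimes> b"
    and ab: "a \<in> carrier S" "b \<in> carrier S"
    using assms(1) unfolding min_group_cong_def by blast
  obtain x' where x': "x' \<in> carrier S" "x \<otimes> x' \<otimes> x = x"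
    using ex1_inverse[OF assms(2)] by blast
  note ec = idempotents_closed[OF e(1)]
  note closed = mult_closed ec assms(2) x'(1) ab
  have "x' \<otimes> x \<otimes> (x' \<otimes> x) = x' \<otimes> (x \<otimes> x' \<otimes> x)"
    by (simp add: mult_assoc closed)
  then have x'x: "x' \<otimes> x \<in> idempotents S"
    using x'(2) by (simp add: idempotents_def closed)
  have conj: "x \<otimes> e \<otimes> x' \<otimes> (x \<otimes> z) = x \<otimes> (e \<otimes> z)" if z: "z \<in> carrier S" for z
  proof -
    have "x \<otimes> e \<otimes> x' \<otimes> (x \<otimes> z) = x \<otimes> (e \<otimes> (x' \<otimes> x \<otimes> z))"
      using z by (simp add: mult_assoc closed)
    also have "\<dots> = x \<otimes> (x' \<otimes> x \<otimes> (e \<otimes> z))"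
      using idempotents_left_commute[OF e(1) x'x z] by simp
    also have "\<dots> = x \<otimes> x' \<otimes> x \<otimes> (e \<otimes> z)"
      using z by (simp add: mult_assoc closed)
    finally show ?thesis
      using x'(2) by simp
  qed
  have "x \<otimes> e \<otimes> x' \<otimes> (x \<otimes> e \<otimes> x') = x \<otimes> e \<otimes> x'"
    using conj[of "e \<otimes> x'"] e(1) by (simp add: mult_assoc closed idempotents_idem_left)
  then have "x \<otimes> e \<otimes> x' \<in> idempotents S"
    by (simp add: idempotents_def closed)
  moreover have "x \<otimes> e \<otimes> x' \<otimes> (x \<otimes> a) = x \<otimes> e \<otimes> x' \<otimes> (x \<otimes> b)"
    using e(2) ab by (simp add: conj)
  ultimately show ?thesis
    unfolding min_group_cong_def by (auto simp: closed)
qed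

end

section \<open>Maximum elements of classes\<close>

context F_inverse_monoid
begin

lemma max_elt_related:
  assumes "a \<in> carrier S"
  shows "(a, max_elt S a) \<in> min_group_cong S"
proof -
  let ?C = "min_group_cong S `` {a}"
  obtain m where m: "is_maximum S ?C m"
    using class_has_maximum[OF quotientI[OF assms]] by blast
  have "?C \<subseteq> carrier S"
    by (auto simp: min_group_cong_def)
  then have "is_maximum S ?C (max_elt S a)"
    unfolding max_elt_def using m is_maximum_unique
    by (intro theI[where P = "is_maximum S ?C" and a = m]) simp_all
  then show ?thesis
    by (simp add: is_maximum_def)
qed

lemma max_elt_closed: "a \<in> carrier S \<Longrightarrow> max_elt S a \<in> carrier S"
  using max_elt_related by (auto simp: min_group_cong_def)

lemma max_elt_eq: "(a, b) \<in> min_group_cong S \<Longrightarrow> max_elt S a = max_elt S b"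
  unfolding max_elt_def by (simp add: min_group_cong_class_eq)

lemma max_elt_context:
  assumes "x \<in> carrier S" "a \<in> carrier S" "y \<in> carrier S"
  shows "max_elt S (x \<otimes> max_elt S a \<otimes> y) = max_elt S (x \<otimes> a \<otimes> y)"
  using assms
  by (intro max_elt_eq[symmetric] min_group_cong_mult_right min_group_cong_mult_left
      max_elt_related)

end

section \<open>Congruences and saturation\<close>

lemma congruence_sandwich:
  fixes S (structure)
  assumes "congruence S \<rho>" "(a, b) \<in> \<rho>" "x \<in> carrier S" "y \<in> carrier S"
  shows "(x \<otimes> a \<otimes> y, x \<otimes> b \<otimes> y) \<in> \<rho>"
proof -
  have "(x, x) \<in> \<rho>" "(y, y) \<in> \<rho>"
    using assms unfolding congruence_def equiv_def refl_on_def by blast+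
  with assms(1,2) show ?thesis
    unfolding congruence_def by blast
qed

lemma saturates_iff:
  assumes "equiv (carrier S) \<rho>"
  shows "saturates S \<rho> H \<longleftrightarrow> H \<subseteq> carrier S \<and> (\<forall>(a, b) \<in> \<rho>. a \<in> H \<longleftrightarrow> b \<in> H)"
proof
  assume "saturates S \<rho> H"
  then obtain \<C> where C: "\<C> \<subseteq> carrier S // \<rho>" "H = \<Union>\<C>"
    unfolding saturates_def by blast
  have "b \<in> H" if "(a, b) \<in> \<rho>" "a \<in> H" for a b
    using C that in_quotient_imp_closed[OF assms] by blast
  moreover have "H \<subseteq> carrier S"
    using C in_quotient_imp_subset[OF assms] by blast
  moreover have "(b, a) \<in> \<rho>" if "(a, b) \<in> \<rho>" for a b
    using assms that unfolding equiv_def sym_def by blast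
  ultimately show "H \<subseteq> carrier S \<and> (\<forall>(a, b) \<in> \<rho>. a \<in> H \<longleftrightarrow> b \<in> H)"
    by blast
next
  assume H: "H \<subseteq> carrier S \<and> (\<forall>(a, b) \<in> \<rho>. a \<in> H \<longleftrightarrow> b \<in> H)"
  have "H = \<Union>(H // \<rho>)"
  proof
    show "H \<subseteq> \<Union>(H // \<rho>)"
      using H equiv_class_self[OF assms] by (auto simp: quotient_def)
    show "\<Union>(H // \<rho>) \<subseteq> H"
      using H by (auto simp: quotient_def)
  qed
  moreover have "H // \<rho> \<subseteq> carrier S // \<rho>"
    using H by (auto simp: quotient_def)
  ultimately show "saturates S \<rho> H"
    unfolding saturates_def by blast
qed

section \<open>The syntactic \<open>F\<close>-congruence\<close>

context F_inverse_monoid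
begin

lemma F_syntactic_congI:
  assumes "a \<in> carrier S" "b \<in> carrier S"
    and "\<And>x y. \<lbrakk>x \<in> carrier S; y \<in> carrier S\<rbrakk> \<Longrightarrow> x \<otimes> a \<otimes> y \<in> H \<longleftrightarrow> x \<otimes> b \<otimes> y \<in> H"
    and "\<And>x y u v. \<lbrakk>x \<in> carrier S; y \<in> carrier S; u \<in> carrier S; v \<in> carrier S\<rbrakk>
      \<Longrightarrow> u \<otimes> max_elt S (x \<otimes> a \<otimes> y) \<otimes> v \<in> H \<longleftrightarrow> u \<otimes> max_elt S (x \<otimes> b \<otimes> y) \<otimes> v \<in> H"
  shows "(a, b) \<in> F_syntactic_cong S H"
  using assms unfolding F_syntactic_cong_def syntactic_cong_def by blast

lemma F_syntactic_congD:
  assumes "(a, b) \<in> F_syntactic_cong S H"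
  shows "a \<in> carrier S" "b \<in> carrier S"
    and "\<lbrakk>x \<in> carrier S; y \<in> carrier S\<rbrakk> \<Longrightarrow> x \<otimes> a \<otimes> y \<in> H \<longleftrightarrow> x \<otimes> b \<otimes> y \<in> H"
    and "\<lbrakk>x \<in> carrier S; y \<in> carrier S; u \<in> carrier S; v \<in> carrier S\<rbrakk>
      \<Longrightarrow> u \<otimes> max_elt S (x \<otimes> a \<otimes> y) \<otimes> v \<in> H \<longleftrightarrow> u \<otimes> max_elt S (x \<otimes> b \<otimes> y) \<otimes> v \<in> H"
  using assms unfolding F_syntactic_cong_def syntactic_cong_def by blast+

lemma equiv_F_syntactic_cong: "equiv (carrier S) (F_syntactic_cong S H)"
proof (rule equivI)
  show "F_syntactic_cong S H \<subseteq> carrier S \<times> carrier S"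
    by (auto dest: F_syntactic_congD(1,2))
  show "refl_on (carrier S) (F_syntactic_cong S H)"
    by (auto intro!: refl_onI F_syntactic_congI)
  show "sym (F_syntactic_cong S H)"
    by (rule symI, rule F_syntactic_congI) (simp_all add: F_syntactic_congD)
  show "trans (F_syntactic_cong S H)"
    by (rule transI, rule F_syntactic_congI) (simp_all add: F_syntactic_congD)
qed

text \<open>A context \<open>x _ y\<close> of \<open>cad\<close> is the context \<open>xc _ dy\<close> of \<open>a\<close>.\<close>

lemma F_syntactic_cong_sandwich:
  assumes ab: "(a, b) \<in> F_syntactic_cong S H" and cd: "c \<in> carrier S" "d \<in> carrier S"
  shows "(c \<otimes> a \<otimes> d, c \<otimes> b \<otimes> d) \<in> F_syntactic_cong S H"
proof -
  note abc = F_syntactic_congD(1,2)[OF ab]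
  have context_comp: "x \<otimes> (c \<otimes> z \<otimes> d) \<otimes> y = (x \<otimes> c) \<otimes> z \<otimes> (d \<otimes> y)"
    if "x \<in> carrier S" "y \<in> carrier S" "z \<in> carrier S" for x y z
    using that cd by (simp add: m_assoc)
  show ?thesis
  proof (rule F_syntactic_congI)
    show "x \<otimes> (c \<otimes> a \<otimes> d) \<otimes> y \<in> H \<longleftrightarrow> x \<otimes> (c \<otimes> b \<otimes> d) \<otimes> y \<in> H"
      if "x \<in> carrier S" "y \<in> carrier S" for x y
      unfolding context_comp[OF that abc(1)] context_comp[OF that abc(2)]
      by (rule F_syntactic_congD(3)[OF ab]) (use that cd in simp_all)
    show "u \<otimes> max_elt S (x \<otimes> (c \<otimes> a \<otimes> d) \<otimes> y) \<otimes> v \<in> H \<longleftrightarrow>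
        u \<otimes> max_elt S (x \<otimes> (c \<otimes> b \<otimes> d) \<otimes> y) \<otimes> v \<in> H"
      if "x \<in> carrier S" "y \<in> carrier S" "u \<in> carrier S" "v \<in> carrier S" for x y u v
      unfolding context_comp[OF that(1,2) abc(1)] context_comp[OF that(1,2) abc(2)]
      by (rule F_syntactic_congD(4)[OF ab]) (use that cd in simp_all)
  qed (use abc cd in simp_all)
qed

lemma congruence_F_syntactic_cong: "congruence S (F_syntactic_cong S H)"
  unfolding congruence_def
proof (intro conjI allI impI)
  fix a b c d
  assume ab: "(a, b) \<in> F_syntactic_cong S H" and cd: "(c, d) \<in> F_syntactic_cong S H"
  note carr = F_syntactic_congD(1,2)[OF ab] F_syntactic_congD(1,2)[OF cd]
  have "(a \<otimes> c, b \<otimes> c) \<in> F_syntactic_cong S H"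
    using F_syntactic_cong_sandwich[OF ab one_closed carr(3)] carr by simp
  moreover have "(b \<otimes> c, b \<otimes> d) \<in> F_syntactic_cong S H"
    using F_syntactic_cong_sandwich[OF cd carr(2) one_closed] carr by simp
  ultimately show "(a \<otimes> c, b \<otimes> d) \<in> F_syntactic_cong S H"
    using equiv_F_syntactic_cong unfolding equiv_def trans_def by blast
qed (rule equiv_F_syntactic_cong)

text \<open>The plain contexts of \<open>a\<^sup>\<mm>\<close> are contexts \<open>u (1a1)\<^sup>\<mm> v\<close> of \<open>a\<close>; in the other contexts the inner
  \<open>\<mm>\<close> is absorbed.\<close>

lemma F_congruence_F_syntactic_cong: "F_congruence S (F_syntactic_cong S H)"
  unfolding F_congruence_def
proof (intro conjI allI impI)
  fix a b
  assume ab: "(a, b) \<in> F_syntactic_cong S H"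
  note carr = F_syntactic_congD(1,2)[OF ab]
  show "(max_elt S a, max_elt S b) \<in> F_syntactic_cong S H"
  proof (rule F_syntactic_congI)
    show "x \<otimes> max_elt S a \<otimes> y \<in> H \<longleftrightarrow> x \<otimes> max_elt S b \<otimes> y \<in> H"
      if "x \<in> carrier S" "y \<in> carrier S" for x y
      using F_syntactic_congD(4)[OF ab one_closed one_closed that] carr by simp
    show "u \<otimes> max_elt S (x \<otimes> max_elt S a \<otimes> y) \<otimes> v \<in> H \<longleftrightarrow>
        u \<otimes> max_elt S (x \<otimes> max_elt S b \<otimes> y) \<otimes> v \<in> H"
      if "x \<in> carrier S" "y \<in> carrier S" "u \<in> carrier S" "v \<in> carrier S" for x y u v
      using F_syntactic_congD(4)[OF ab that] that carr by (simp add: max_elt_context)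
  qed (use carr max_elt_closed in simp_all)
qed (rule congruence_F_syntactic_cong)

lemma saturates_F_syntactic_cong:
  assumes "H \<subseteq> carrier S"
  shows "saturates S (F_syntactic_cong S H) H"
proof -
  have "a \<in> H \<longleftrightarrow> b \<in> H" if "(a, b) \<in> F_syntactic_cong S H" for a b
    using F_syntactic_congD(3)[OF that one_closed one_closed] F_syntactic_congD(1,2)[OF that]
    by simp
  with assms show ?thesis
    unfolding saturates_iff[OF equiv_F_syntactic_cong] by blast
qed

lemma F_syntactic_cong_greatest:
  assumes F: "F_congruence S \<rho>" and sat: "saturates S \<rho> H"
  shows "\<rho> \<subseteq> F_syntactic_cong S H"
proof (rule subrelI)
  fix a b
  assume ab: "(a, b) \<in> \<rho>"
  have cong: "congruence S \<rho>" and max: "\<And>c d. (c, d) \<in> \<rho> \<Longrightarrow> (max_elt S c, max_elt S d) \<in> \<rho>"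
    using F by (simp_all add: F_congruence_def)
  then have equiv: "equiv (carrier S) \<rho>"
    by (simp add: congruence_def)
  have H: "c \<in> H \<longleftrightarrow> d \<in> H" if "(c, d) \<in> \<rho>" for c d
    using sat that unfolding saturates_iff[OF equiv] by blast
  show "(a, b) \<in> F_syntactic_cong S H"
  proof (rule F_syntactic_congI)
    show "a \<in> carrier S" "b \<in> carrier S"
      using equiv_type[OF equiv] ab by blast+
  qed (intro H congruence_sandwich[OF cong] max ab; assumption)+
qed

end

theorem proposition5p1:
  fixes S :: "('a, 'm) monoid_scheme" and H :: "'a set"
  assumes "F_inverse_monoid S"
    and "H \<subseteq> carrier S"
  shows "F_congruence S (F_syntactic_cong S H) \<and>
    saturates S (F_syntactic_cong S H) H \<and>
    (\<forall>\<rho>. F_congruence S \<rho> \<and> saturates S \<rho> H \<longrightarrow> \<rho> \<subseteq> F_syntactic_cong S H)"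
proof -
  interpret F_inverse_monoid S
    by (rule assms(1))
  show ?thesis
    using F_congruence_F_syntactic_cong saturates_F_syntactic_cong[OF assms(2)]
      F_syntactic_cong_greatest by blast
qed

end
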